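(* Let $\mathcal{S}$ be a set chosen to satisfy the truncation conditions (T) of the context, such that no subset $\mathcal{S}_s$ of $\mathcal{S}$ with $\mu(\mathcal{S}_s)<\mu(\mathcal{S})$ satisfies (T). Let $B(\bm{\xi})=\max_{k=1,\dots,P}|\psi_k(\bm{\xi})|$. If we sample from the distribution on $\mathcal{S}$ proportional to $f(\bm{\xi})B^2(\bm{\xi})$ and weight $\psi_k(\bm{\xi})$ proportionally to $w(\bm{\xi})=1/B(\bm{\xi})$, then the coherence parameter (for the selected $\mathcal{S}$) achieves a minimum over all sampling schemes of $\psi_k(\bm{\xi})$, $k=1,\dots,P$, and distributions supported on $\mathcal{S}$; that is, for every sampling scheme on $\mathcal{S}$ given by a function $G$, $$\sup_{k=1,\dots,P,\ \bm{\xi}\in\mathcal{S}}|w_B(\bm{\xi})\psi_k(\bm{\xi})|^2\ \le\ \sup_{k=1,\dots,P,\ \bm{\xi}\in\mathcal{S}}|w_G(\bm{\xi})\psi_k(\bm{\xi})|^2 .$$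
   Context: Let $f$ be a probability density on $\mathbb{R}^d$ that is the product of $d$ copies of a univariate density, and let $\psi_1,\dots,\psi_P$, $P=\binom{p+d}{d}$, be the tensor-product polynomials of total degree at most $p$ that are orthonormal with respect to $f$ (for instance multivariate Hermite or Legendre polynomials, the constant polynomial $1$ being included). Sampling scheme on $\mathcal{S}$: for a measurable function $G:\mathcal{S}\to(0,\infty)$ with $0<\int_{\mathcal{S}}fG^2\,d\bm{\xi}<\infty$, put $c_G=\big(\int_{\mathcal{S}}f(\bm{\xi})G^2(\bm{\xi})\,d\bm{\xi}\big)^{-1/2}$. The scheme samples $\bm{Y}$ from the density $c_G^2f(\bm{\xi})G^2(\bm{\xi})$ on $\mathcal{S}$ and uses the weight function $w_G(\bm{\xi})=1/(c_GG(\bm{\xi}))$. The scheme in the theorem is $G=B$. Coherence: for a scheme with sampled vector $\bm{Y}$ and weight $w$, and a set $\mathcal{A}$ contained in the support of $f$, write $\mu(\mathcal{A})=\sup_{k=1,\dots,P,\ \bm{\xi}\in\mathcal{A}}|w(\bm{\xi})\psi_k(\bm{\xi})|^2$. With $N$ the number of independent samples taken, the truncation conditions (T) on a set $\mathcal{A}$ are $$\mathbb{P}(\mathcal{A}^c)<\frac{1}{NP},\qquad \sum_{k=1}^P\mathbb{E}\big[|w(\bm{Y})\psi_k(\bm{Y})|^2\mathbf{1}_{\mathcal{A}^c}\big]\le\frac{1}{20}P^{-1/2},$$ where $\mathbb{P}(\mathcal{A}^c)$ is the probability that the sampled vector lies in $\mathcal{A}^c$. The coherence parameter $\mu(\bm{Y})$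 is the minimum of $\mu(\mathcal{A})$ over sets $\mathcal{A}$ satisfying (T); for the selected set $\mathcal{S}$ it is $\mu(\mathcal{S})$. In the theorem, the hypothesis on $\mathcal{S}$ refers to the scheme $G=B$. *)

theory Defs
  imports "HOL-Probability.Probability" "HOL-Computational_Algebra.Polynomial"
begin

definition univariate_density :: "(real \<Rightarrow> real) \<Rightarrow> bool" where
  "univariate_density g \<longleftrightarrow>
     g \<in> borel_measurable borel \<and> (\<forall>x. 0 \<le> g x) \<and>
     prob_space (density lborel (\<lambda>x. ennreal (g x)))"

definition product_density :: "(real \<Rightarrow> real) \<Rightarrow> real ^ 'd \<Rightarrow> real" where
  "product_density g \<xi> = (\<Prod>i\<in>UNIV. g (\<xi> $ i))"

definition density_support :: "(real ^ 'd \<Rightarrow> real) \<Rightarrow> (real ^ 'd) set" where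
  "density_support f = closure {\<xi>. f \<xi> \<noteq> 0}"

text \<open>The number of multi-indices of total degree at most \<open>p\<close> in \<open>d\<close> variables, where the
  dimension \<open>d\<close> is the cardinality of the index type.\<close>

definition num_basis :: "'d::finite itself \<Rightarrow> nat \<Rightarrow> nat" where
  "num_basis _ p = (p + CARD('d)) choose CARD('d)"

text \<open>The enumeration \<open>idx\<close> of the multi-indices of total degree at most \<open>p\<close> is arbitrary;
  \<open>q n\<close> is the univariate polynomial of degree \<open>n\<close> from which the tensor products are built.
  Orthonormality of the \<open>\<psi> k\<close> includes the existence of the integrals, since the
  Bochner integral of a non-integrable function is \<open>0\<close>.\<close>

definition orthonormal_tensor_basis ::
    "(real ^ 'd \<Rightarrow> real) \<Rightarrow> nat \<Rightarrow> (nat \<Rightarrow> real ^ 'd \<Rightarrow> real) \<Rightarrow> bool" where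
  "orthonormal_tensor_basis f p \<psi> \<longleftrightarrow>
     (\<exists>(q :: nat \<Rightarrow> real poly) (idx :: nat \<Rightarrow> 'd \<Rightarrow> nat).
        (\<forall>n\<le>p. degree (q n) = n) \<and>
        bij_betw idx {1..num_basis TYPE('d) p} {\<alpha>. (\<Sum>i\<in>UNIV. \<alpha> i) \<le> p} \<and>
        (\<forall>k\<in>{1..num_basis TYPE('d) p}. \<forall>\<xi>.
           \<psi> k \<xi> = (\<Prod>i\<in>UNIV. poly (q (idx k i)) (\<xi> $ i)))) \<and>
     (\<forall>j\<in>{1..num_basis TYPE('d) p}. \<forall>k\<in>{1..num_basis TYPE('d) p}.
        integrable lborel (\<lambda>\<xi>. f \<xi> * \<psi> j \<xi> * \<psi> k \<xi>) \<and>
        (LINT \<xi>|lborel. f \<xi> * \<psi> j \<xi> * \<psi> k \<xi>) = of_bool (j = k)) \<and>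
     (\<exists>k\<in>{1..num_basis TYPE('d) p}. \<forall>\<xi>. \<psi> k \<xi> = 1)"

text \<open>A function \<open>G\<close> on \<open>S\<close> is represented by a total function whose
  values outside \<open>S\<close> are irrelevant; the scheme's law has space \<open>S\<close>.\<close>

definition sampling_scheme ::
    "(real ^ 'd \<Rightarrow> real) \<Rightarrow> (real ^ 'd) set \<Rightarrow> (real ^ 'd \<Rightarrow> real) \<Rightarrow> bool" where
  "sampling_scheme f S G \<longleftrightarrow>
     G \<in> borel_measurable (restrict_space borel S) \<and> (\<forall>\<xi>\<in>S. 0 < G \<xi>) \<and>
     set_integrable lborel S (\<lambda>\<xi>. f \<xi> * (G \<xi>)\<^sup>2) \<and>
     0 < (LINT \<xi>:S|lborel. f \<xi> * (G \<xi>)\<^sup>2)"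

definition scheme_const ::
    "(real ^ 'd \<Rightarrow> real) \<Rightarrow> (real ^ 'd) set \<Rightarrow> (real ^ 'd \<Rightarrow> real) \<Rightarrow> real" where
  "scheme_const f S G = (LINT \<xi>:S|lborel. f \<xi> * (G \<xi>)\<^sup>2) powr (- 1 / 2)"

definition scheme_law ::
    "(real ^ 'd \<Rightarrow> real) \<Rightarrow> (real ^ 'd) set \<Rightarrow> (real ^ 'd \<Rightarrow> real) \<Rightarrow> (real ^ 'd) measure" where
  "scheme_law f S G =
     density (restrict_space lborel S)
       (\<lambda>\<xi>. ennreal ((scheme_const f S G)\<^sup>2 * f \<xi> * (G \<xi>)\<^sup>2))"

definition scheme_weight ::
    "(real ^ 'd \<Rightarrow> real) \<Rightarrow> (real ^ 'd) set \<Rightarrow> (real ^ 'd \<Rightarrow> real) \<Rightarrow> real ^ 'd \<Rightarrow> real" where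
  "scheme_weight f S G \<xi> = 1 / (scheme_const f S G * G \<xi>)"

text \<open>The supremum may be infinite, hence it is taken in \<^typ>\<open>ennreal\<close>.\<close>

definition coherence ::
    "nat \<Rightarrow> (nat \<Rightarrow> real ^ 'd \<Rightarrow> real) \<Rightarrow> (real ^ 'd \<Rightarrow> real) \<Rightarrow> (real ^ 'd) set \<Rightarrow> ennreal" where
  "coherence P \<psi> w A = (SUP (k, \<xi>)\<in>{1..P} \<times> A. ennreal (\<bar>w \<xi> * \<psi> k \<xi>\<bar>\<^sup>2))"

text \<open>Here \<open>\<mu>\<close> is the law of the sampled vector and \<open>w\<close> the weight of the scheme. The
  expectations are nonnegative integrals, so that an infinite one violates the bound.\<close>

definition truncation_conditions ::
    "nat \<Rightarrow> nat \<Rightarrow> (nat \<Rightarrow> real ^ 'd \<Rightarrow> real) \<Rightarrow> (real ^ 'd) measure \<Rightarrow> (real ^ 'd \<Rightarrow> real) \<Rightarrow>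
     (real ^ 'd) set \<Rightarrow> bool" where
  "truncation_conditions N P \<psi> \<mu> w A \<longleftrightarrow>
     \<P>(\<xi> in \<mu>. \<xi> \<notin> A) < 1 / (real N * real P) \<and>
     (\<Sum>k=1..P. \<integral>\<^sup>+\<xi>. ennreal (\<bar>w \<xi> * \<psi> k \<xi>\<bar>\<^sup>2) * indicator (- A) \<xi> \<partial>\<mu>)
       \<le> ennreal (1 / 20 * real P powr (- 1 / 2))"

definition max_basis :: "nat \<Rightarrow> (nat \<Rightarrow> real ^ 'd \<Rightarrow> real) \<Rightarrow> real ^ 'd \<Rightarrow> real" where
  "max_basis P \<psi> \<xi> = (MAX k\<in>{1..P}. \<bar>\<psi> k \<xi>\<bar>)"

end

theory Submission
  imports Defs
begin

text \<open>
  Write \<open>I\<^sub>G\<close> for the integral of \<open>f G\<^sup>2\<close> over \<open>S\<close>. The normalisation of the sampling density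
  forces \<open>w\<^sub>G\<^sup>2 = I\<^sub>G / G\<^sup>2\<close>, so the coherence of the scheme \<open>G\<close> on \<open>S\<close> is
  \<open>I\<^sub>G \<cdot> sup\<^sub>S (B/G)\<^sup>2\<close>, where \<open>B\<close> is the pointwise maximum of the \<open>\<bar>\<psi> k\<bar>\<close>. Choosing \<open>G = B\<close>
  makes the supremum equal to one and gives the value \<open>I\<^sub>B\<close>. For any other \<open>G\<close> with finite
  coherence \<open>M\<close> the pointwise inequality \<open>I\<^sub>G B\<^sup>2 \<le> M G\<^sup>2\<close> holds on \<open>S\<close>; multiplying by the
  nonnegative density \<open>f\<close> and integrating gives \<open>I\<^sub>G I\<^sub>B \<le> M I\<^sub>G\<close>, hence \<open>I\<^sub>B \<le> M\<close>. In other
  words, a supremum is at least the average with respect to the sampling law, and the average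
  of \<open>(w\<^sub>G B)\<^sup>2\<close> with respect to the law of the scheme \<open>G\<close> is \<open>I\<^sub>B\<close> whatever \<open>G\<close> is
  (\<open>coherence_ge_integral\<close>); for \<open>G = B\<close> the function \<open>(w\<^sub>G B)\<^sup>2\<close> is constant and the bound is
  attained (\<open>coherence_max_basis_le\<close>).

  That \<open>B\<close> itself defines a scheme uses the structure of the basis: \<open>B\<close> is positive because the
  constant \<open>1\<close> is among the \<open>\<psi> k\<close>, it is measurable because the \<open>\<psi> k\<close> are polynomials, and
  \<open>f B\<^sup>2\<close> is integrable because it lies below \<open>\<Sum>k. f (\<psi> k)\<^sup>2\<close>, a sum of \<open>P\<close> functions with
  integral one (\<open>sampling_scheme_max_basis\<close>).
\<close>

lemma product_density_nonneg:
  assumes "univariate_density g"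
  shows "0 \<le> product_density g \<xi>"
  using assms unfolding product_density_def univariate_density_def by (simp add: prod_nonneg)

lemma abs_le_max_basis: "k \<in> {1..P} \<Longrightarrow> \<bar>\<psi> k \<xi>\<bar> \<le> max_basis P \<psi> \<xi>"
  unfolding max_basis_def by (rule Max_ge) auto

lemma max_basis_attained:
  assumes "1 \<le> P"
  obtains k where "k \<in> {1..P}" "max_basis P \<psi> \<xi> = \<bar>\<psi> k \<xi>\<bar>"
proof -
  have "max_basis P \<psi> \<xi> \<in> (\<lambda>k. \<bar>\<psi> k \<xi>\<bar>) ` {1..P}"
    unfolding max_basis_def using assms by (intro Max_in) auto
  then show thesis using that by blast
qed

lemma max_basis_sq_le_sum:
  assumes "1 \<le> P"
  shows "(max_basis P \<psi> \<xi>)\<^sup>2 \<le> (\<Sum>k=1..P. (\<psi> k \<xi>)\<^sup>2)"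
proof -
  obtain k where "k \<in> {1..P}" "max_basis P \<psi> \<xi> = \<bar>\<psi> k \<xi>\<bar>"
    using assms by (rule max_basis_attained)
  then show ?thesis
    using member_le_sum[of k "{1..P}" "\<lambda>k. (\<psi> k \<xi>)\<^sup>2"] by simp
qed

lemma max_basis_measurable:
  assumes "\<And>k. k \<in> {1..P} \<Longrightarrow> \<psi> k \<in> borel_measurable borel"
  shows "max_basis P \<psi> \<in> borel_measurable borel"
proof -
  have "(\<lambda>\<xi>. MAX k\<in>{1..P}. \<bar>\<psi> k \<xi>\<bar>) \<in> borel_measurable borel"
    using assms by (intro borel_measurable_Max) auto
  then show ?thesis by (simp add: max_basis_def[abs_def])
qed

lemma orthonormal_tensor_basis_measurable:
  fixes \<psi> :: "nat \<Rightarrow> real ^ 'd \<Rightarrow> real"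
  assumes "orthonormal_tensor_basis f p \<psi>" "k \<in> {1..num_basis TYPE('d) p}"
  shows "\<psi> k \<in> borel_measurable borel"
proof -
  obtain q :: "nat \<Rightarrow> real poly" and idx :: "nat \<Rightarrow> 'd \<Rightarrow> nat"
    where "\<forall>\<xi>. \<psi> k \<xi> = (\<Prod>i\<in>UNIV. poly (q (idx k i)) (\<xi> $ i))"
    using assms unfolding orthonormal_tensor_basis_def by blast
  then have "\<psi> k = (\<lambda>\<xi>. \<Prod>i\<in>UNIV. poly (q (idx k i)) (\<xi> $ i))" by auto
  moreover have "continuous_on UNIV (\<lambda>\<xi>::real ^ 'd. \<Prod>i\<in>UNIV. poly (q (idx k i)) (\<xi> $ i))"
    by (intro continuous_intros)
  ultimately show ?thesis by (simp add: borel_measurable_continuous_onI)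
qed

lemma orthonormal_tensor_basis_const_one:
  fixes \<psi> :: "nat \<Rightarrow> real ^ 'd \<Rightarrow> real"
  assumes "orthonormal_tensor_basis f p \<psi>"
  obtains k where "k \<in> {1..num_basis TYPE('d) p}" "\<And>\<xi>. \<psi> k \<xi> = 1"
  using assms unfolding orthonormal_tensor_basis_def by blast

lemma orthonormal_tensor_basis_integrable:
  fixes \<psi> :: "nat \<Rightarrow> real ^ 'd \<Rightarrow> real"
  assumes "orthonormal_tensor_basis f p \<psi>"
    and "j \<in> {1..num_basis TYPE('d) p}" "k \<in> {1..num_basis TYPE('d) p}"
  shows "integrable lborel (\<lambda>\<xi>. f \<xi> * \<psi> j \<xi> * \<psi> k \<xi>)"
  using assms unfolding orthonormal_tensor_basis_def by blast

text \<open>Domination by \<open>\<Sum>k. f (\<psi> k)\<^sup>2\<close> gives integrability of \<open>f B\<^sup>2\<close>; its integral over \<open>S\<close>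
  can still vanish, namely when \<open>f\<close> vanishes almost everywhere on \<open>S\<close>.\<close>

lemma sampling_scheme_max_basis:
  fixes f :: "real ^ 'd \<Rightarrow> real" and \<psi> :: "nat \<Rightarrow> real ^ 'd \<Rightarrow> real" and p :: nat
  defines "B \<equiv> max_basis (num_basis TYPE('d) p) \<psi>"
  assumes basis: "orthonormal_tensor_basis f p \<psi>"
    and nonneg: "\<And>\<xi>. 0 \<le> f \<xi>"
    and S: "S \<in> sets borel"
    and pos: "0 < (LINT \<xi>:S|lborel. f \<xi> * (B \<xi>)\<^sup>2)"
  shows "sampling_scheme f S B"
proof -
  let ?P = "num_basis TYPE('d) p"
  obtain k1 where k1: "k1 \<in> {1..?P}" "\<And>\<xi>. \<psi> k1 \<xi> = 1"
    using orthonormal_tensor_basis_const_one[OF basis] by blast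
  then have P: "1 \<le> ?P" by simp
  have B_pos: "0 < B \<xi>" for \<xi>
    using abs_le_max_basis[OF k1(1), of \<psi> \<xi>] k1(2) by (simp add: B_def)
  have B_meas [measurable]: "B \<in> borel_measurable borel"
    unfolding B_def using orthonormal_tensor_basis_measurable[OF basis]
    by (rule max_basis_measurable)
  \<comment> \<open>Pairing the constant basis function with itself exhibits \<open>f\<close> as one of the integrands.\<close>
  have "integrable lborel f"
    using orthonormal_tensor_basis_integrable[OF basis k1(1) k1(1)] k1(2) by simp
  then have f_meas [measurable]: "f \<in> borel_measurable borel"
    using borel_measurable_integrable by fastforce
  have "integrable lborel (\<lambda>\<xi>. \<Sum>k=1..?P. f \<xi> * \<psi> k \<xi> * \<psi> k \<xi>)"
    using orthonormal_tensor_basis_integrable[OF basis] by (intro Bochner_Integration.integrable_sum) auto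
  then have "integrable lborel (\<lambda>\<xi>. f \<xi> * (B \<xi>)\<^sup>2)"
  proof (rule Bochner_Integration.integrable_bound)
    have "norm (f \<xi> * (B \<xi>)\<^sup>2) \<le> norm (\<Sum>k=1..?P. f \<xi> * \<psi> k \<xi> * \<psi> k \<xi>)" for \<xi>
    proof -
      have "f \<xi> * (B \<xi>)\<^sup>2 \<le> f \<xi> * (\<Sum>k=1..?P. (\<psi> k \<xi>)\<^sup>2)"
        unfolding B_def by (intro mult_left_mono max_basis_sq_le_sum P nonneg)
      also have "\<dots> = (\<Sum>k=1..?P. f \<xi> * \<psi> k \<xi> * \<psi> k \<xi>)"
        by (simp add: sum_distrib_left power2_eq_square mult.assoc)
      finally show ?thesis using nonneg[of \<xi>] by simp
    qed
    then show "AE \<xi> in lborel. norm (f \<xi> * (B \<xi>)\<^sup>2) \<le> norm (\<Sum>k=1..?P. f \<xi> * \<psi> k \<xi> * \<psi> k \<xi>)"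
      by simp
  qed measurable
  then have "set_integrable lborel S (\<lambda>\<xi>. f \<xi> * (B \<xi>)\<^sup>2)"
    unfolding set_integrable_def using S by (intro integrable_mult_indicator) auto
  then show ?thesis
    using pos B_pos B_meas
    by (simp add: sampling_scheme_def measurable_restrict_space1)
qed

lemma scheme_weight_sq:
  assumes "0 < (LINT \<xi>:S|lborel. f \<xi> * (G \<xi>)\<^sup>2)"
  shows "\<bar>scheme_weight f S G \<xi> * y\<bar>\<^sup>2 = (LINT \<xi>:S|lborel. f \<xi> * (G \<xi>)\<^sup>2) * (y\<^sup>2 / (G \<xi>)\<^sup>2)"
proof -
  let ?I = "LINT \<xi>:S|lborel. f \<xi> * (G \<xi>)\<^sup>2"
  have "(scheme_const f S G)\<^sup>2 = ?I powr (- 1)"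
    by (simp add: scheme_const_def power2_eq_square flip: powr_add)
  then have "(scheme_const f S G)\<^sup>2 = 1 / ?I"
    using assms by (simp add: powr_minus_divide)
  then show ?thesis
    by (simp add: scheme_weight_def power_mult_distrib power_divide)
qed

lemma coherence_max_basis_le:
  fixes S :: "(real ^ 'd) set"
  assumes pos: "0 < (LINT \<xi>:S|lborel. f \<xi> * (max_basis P \<psi> \<xi>)\<^sup>2)"
  shows "coherence P \<psi> (scheme_weight f S (max_basis P \<psi>)) S
           \<le> ennreal (LINT \<xi>:S|lborel. f \<xi> * (max_basis P \<psi> \<xi>)\<^sup>2)"
proof -
  have "\<bar>scheme_weight f S (max_basis P \<psi>) \<xi> * \<psi> k \<xi>\<bar>\<^sup>2
          \<le> (LINT \<xi>:S|lborel. f \<xi> * (max_basis P \<psi> \<xi>)\<^sup>2)" if "k \<in> {1..P}" for k \<xi>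
  proof -
    have "(\<psi> k \<xi>)\<^sup>2 \<le> (max_basis P \<psi> \<xi>)\<^sup>2"
      using power_mono[OF abs_le_max_basis[OF that, of \<psi> \<xi>], of 2] by simp
    then have "(\<psi> k \<xi>)\<^sup>2 / (max_basis P \<psi> \<xi>)\<^sup>2 \<le> 1"
      by (simp add: divide_le_eq_1)
    then show ?thesis
      unfolding scheme_weight_sq[OF pos] using pos by (intro mult_left_le) auto
  qed
  then show ?thesis
    unfolding coherence_def by (auto intro!: SUP_least ennreal_leI)
qed

text \<open>The universal lower bound: \<open>(w\<^sub>G B)\<^sup>2\<close> has mean \<open>I\<^sub>B\<close> under the law of the scheme \<open>G\<close>, so
  its supremum on \<open>S\<close> cannot be smaller.\<close>

lemma coherence_ge_integral:
  fixes S :: "(real ^ 'd) set"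
  assumes P: "1 \<le> P"
    and nonneg: "\<And>\<xi>. 0 \<le> f \<xi>"
    and B_int: "set_integrable lborel S (\<lambda>\<xi>. f \<xi> * (max_basis P \<psi> \<xi>)\<^sup>2)"
    and G: "sampling_scheme f S G"
  shows "ennreal (LINT \<xi>:S|lborel. f \<xi> * (max_basis P \<psi> \<xi>)\<^sup>2)
           \<le> coherence P \<psi> (scheme_weight f S G) S"
proof (cases "coherence P \<psi> (scheme_weight f S G) S")
  case (real M)
  let ?B = "max_basis P \<psi>"
  let ?IB = "LINT \<xi>:S|lborel. f \<xi> * (?B \<xi>)\<^sup>2"
  let ?IG = "LINT \<xi>:S|lborel. f \<xi> * (G \<xi>)\<^sup>2"
  have G_pos: "\<And>\<xi>. \<xi> \<in> S \<Longrightarrow> 0 < G \<xi>"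
    and G_int: "set_integrable lborel S (\<lambda>\<xi>. f \<xi> * (G \<xi>)\<^sup>2)"
    and IG_pos: "0 < ?IG"
    using G by (auto simp: sampling_scheme_def)
  have pointwise: "?IG * (?B \<xi>)\<^sup>2 \<le> M * (G \<xi>)\<^sup>2" if "\<xi> \<in> S" for \<xi>
  proof -
    obtain k where k: "k \<in> {1..P}" "?B \<xi> = \<bar>\<psi> k \<xi>\<bar>"
      using P by (rule max_basis_attained)
    have "ennreal (\<bar>scheme_weight f S G \<xi> * \<psi> k \<xi>\<bar>\<^sup>2) \<le> coherence P \<psi> (scheme_weight f S G) S"
      unfolding coherence_def using k(1) that by (intro SUP_upper2[of "(k, \<xi>)"]) auto
    then have "\<bar>scheme_weight f S G \<xi> * \<psi> k \<xi>\<bar>\<^sup>2 \<le> M"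
      using real by (simp add: ennreal_le_iff)
    then have "?IG * ((\<psi> k \<xi>)\<^sup>2 / (G \<xi>)\<^sup>2) \<le> M"
      by (simp only: scheme_weight_sq[OF IG_pos])
    then show ?thesis
      using G_pos[OF that] k(2) by (simp add: pos_divide_le_eq)
  qed
  have "?IG * ?IB = (LINT \<xi>:S|lborel. ?IG * (f \<xi> * (?B \<xi>)\<^sup>2))"
    by simp
  also have "\<dots> \<le> (LINT \<xi>:S|lborel. M * (f \<xi> * (G \<xi>)\<^sup>2))"
  proof (rule set_integral_mono)
    show "set_integrable lborel S (\<lambda>\<xi>. ?IG * (f \<xi> * (?B \<xi>)\<^sup>2))"
      using B_int by (rule set_integrable_mult_right)
    show "set_integrable lborel S (\<lambda>\<xi>. M * (f \<xi> * (G \<xi>)\<^sup>2))"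
      using G_int by (rule set_integrable_mult_right)
    show "?IG * (f \<xi> * (?B \<xi>)\<^sup>2) \<le> M * (f \<xi> * (G \<xi>)\<^sup>2)" if "\<xi> \<in> S" for \<xi>
      using mult_left_mono[OF pointwise[OF that] nonneg[of \<xi>]] by (simp only: mult.left_commute)
  qed
  also have "\<dots> = ?IG * M"
    by simp
  finally have "?IB \<le> M"
    using IG_pos by simp
  then show ?thesis
    using real by (simp add: ennreal_leI)
next
  case top
  then show ?thesis by simp
qed

theorem theorem4p5:
  fixes g :: "real \<Rightarrow> real" and f B :: "real ^ 'd \<Rightarrow> real"
    and \<psi> :: "nat \<Rightarrow> real ^ 'd \<Rightarrow> real" and p P N :: nat and S :: "(real ^ 'd) set"
  assumes "univariate_density g"
    and "f = product_density g"
    and "P = num_basis TYPE('d) p"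
    and "orthonormal_tensor_basis f p \<psi>"
    and "1 \<le> N"
    and "B = max_basis P \<psi>"
    and "S \<in> sets borel" and "S \<subseteq> density_support f"
    and "0 < (LINT \<xi>:S|lborel. f \<xi> * (B \<xi>)\<^sup>2)"
    and "truncation_conditions N P \<psi> (scheme_law f S B) (scheme_weight f S B) S"
    and "\<And>S\<^sub>s. S\<^sub>s \<in> sets borel \<Longrightarrow> S\<^sub>s \<subseteq> S \<Longrightarrow>
           coherence P \<psi> (scheme_weight f S B) S\<^sub>s < coherence P \<psi> (scheme_weight f S B) S \<Longrightarrow>
           \<not> truncation_conditions N P \<psi> (scheme_law f S B) (scheme_weight f S B) S\<^sub>s"
  shows "sampling_scheme f S B \<and>
    (\<forall>G. sampling_scheme f S G \<longrightarrow>
       coherence P \<psi> (scheme_weight f S B) S \<le> coherence P \<psi> (scheme_weight f S G) S)"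
proof (intro conjI allI impI)
  have nonneg: "0 \<le> f \<xi>" for \<xi>
    using assms(1,2) by (simp add: product_density_nonneg)
  show B_scheme: "sampling_scheme f S B"
    using sampling_scheme_max_basis[OF assms(4) nonneg assms(7)] assms(3,6,9) by simp
  have P: "1 \<le> P"
    using orthonormal_tensor_basis_const_one[OF assms(4)] assms(3) by fastforce
  fix G
  assume "sampling_scheme f S G"
  then have "ennreal (LINT \<xi>:S|lborel. f \<xi> * (B \<xi>)\<^sup>2) \<le> coherence P \<psi> (scheme_weight f S G) S"
    using coherence_ge_integral[of P f S \<psi> G, OF P nonneg] B_scheme assms(6) by (simp add: sampling_scheme_def)
  then show "coherence P \<psi> (scheme_weight f S B) S \<le> coherence P \<psi> (scheme_weight f S G) S"
    using coherence_max_basis_le[of S f P \<psi>] assms(6,9) by (auto intro: order_trans)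
qed

end
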